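(* Let $L_1$ be a line in $\mathbb{R}^2$ not containing the origin $O$. Let $L_2$ be the line through $O$ perpendicular to $L_1$, and let $P_1$ be the point of intersection of $L_1$ and $L_2$. Then the inverse point of $P_1$ with respect to the unit circle $x^2+y^2=1$ is the dual point $P$ of $L_1$. Conversely, let $P\neq O$ be a point of $\mathbb{R}^2$, let $P_1$ be the inverse point of $P$ with respect to the unit circle $x^2+y^2=1$, and let $L_1$ be the line through $P_1$ perpendicular to the line $L_2$ through $O$ and $P$. Then $L_1$ is the dual line of $P$.
   Context: Duality in the plane $\mathbb{R}^2$ (the original plane and the dual plane are identified): the dual of a point $(a,b)\neq(0,0)$ is the line $\{(x,y): ax+by=1\}$. A line not containing the origin can be written uniquely as $cx+dy=1$ with $(c,d)\neq(0,0)$, and its dual is the point $(c,d)$. Duals of lines through the origin are not taken. The inverse of a point $Q\neq O$ with respect to the unit circle is the point $Q'$ on the ray from $O$ through $Q$ with $|OQ|\cdot|OQ'|=1$. *)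

theory Defs
  imports "HOL-Analysis.Analysis"
begin

definition is_line :: "(real^2) set \<Rightarrow> bool" where
  "is_line L \<longleftrightarrow> affine L \<and> aff_dim L = 1"

definition perp_lines :: "(real^2) set \<Rightarrow> (real^2) set \<Rightarrow> bool" where
  "perp_lines L M \<longleftrightarrow> is_line L \<and> is_line M \<and>
     (\<forall>x\<in>L. \<forall>y\<in>L. \<forall>u\<in>M. \<forall>v\<in>M. orthogonal (x - y) (u - v))"

text \<open>The next three notions are meaningful only for points other than the origin and
  for lines not containing the origin.\<close>

definition dual_line :: "real^2 \<Rightarrow> (real^2) set" where
  "dual_line P = {X. P $ 1 * X $ 1 + P $ 2 * X $ 2 = 1}"

definition dual_point :: "(real^2) set \<Rightarrow> real^2" where
  "dual_point L = (THE P. P \<noteq> 0 \<and> L = dual_line P)"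

definition inverse_point :: "real^2 \<Rightarrow> real^2" where
  "inverse_point Q = (THE Q'. (\<exists>t\<ge>0. Q' = t *\<^sub>R Q) \<and> dist 0 Q * dist 0 Q' = 1)"

text \<open>The descriptions are well-defined on their intended domains.\<close>

lemma is_line_param:
  assumes "is_line L"
  obtains a d where "d \<noteq> 0" "L = {a + t *\<^sub>R d | t. True}"
proof -
  have aff: "affine L" and dim: "aff_dim L = 1" using assms by (auto simp: is_line_def)
  have "L \<noteq> {}" using dim by auto
  then obtain a where a: "a \<in> L" by auto
  have "L \<noteq> {a}" using dim by auto
  then obtain b where b: "b \<in> L" "b \<noteq> a" using a by auto
  have sub: "affine hull {a, b} \<subseteq> L" using a b aff by (simp add: hull_minimal)
  have d1: "aff_dim (affine hull {a, b}) = 1" using b by (simp add: aff_dim_2)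
  have eq: "affine hull {a, b} = L"
    using affine_dim_equal[OF affine_affine_hull aff _ sub] d1 dim by auto
  have "L = {a + t *\<^sub>R (b - a) | t. True}"
    unfolding eq[symmetric] affine_hull_2_alt by auto
  then show ?thesis using b that[of "b - a" a] by auto
qed

lemma ex1_dual_point:
  assumes "is_line L" "0 \<notin> L"
  shows "\<exists>!P. P \<noteq> 0 \<and> L = dual_line P"
proof -
  obtain a d where d: "d \<noteq> 0" and L: "L = {a + t *\<^sub>R d | t. True}"
    using is_line_param[OF assms(1)] by blast
  define k where "k = a$1 * d$2 - a$2 * d$1"
  have d2: "d$1 \<noteq> 0 \<or> d$2 \<noteq> 0" using d by (auto simp: vec_eq_iff forall_2)
  have k: "k \<noteq> 0"
  proof
    assume k0: "k = 0"
    have "\<exists>t. a + t *\<^sub>R d = 0"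
    proof (cases "d$1 = 0")
      case True
      then show ?thesis using k0 d2
        by (intro exI[of _ "- a$2 / d$2"]) (auto simp: k_def vec_eq_iff forall_2 field_simps)
    next
      case False
      then show ?thesis using k0
        by (intro exI[of _ "- a$1 / d$1"]) (auto simp: k_def vec_eq_iff forall_2 field_simps)
    qed
    then show False using assms(2) unfolding L by force
  qed
  define P :: "real^2" where "P = vector [d$2 / k, - d$1 / k]"
  have P: "P$1 = d$2 / k" "P$2 = - d$1 / k" by (simp_all add: P_def)
  have aL: "a \<in> L" unfolding L by (auto intro: exI[of _ 0])
  have adL: "a + d \<in> L" unfolding L by (auto intro: exI[of _ 1])
  have mem: "X \<in> dual_line P \<longleftrightarrow> X \<in> L" for X
  proof -
    have "X \<in> dual_line P \<longleftrightarrow> d$2 * X$1 - d$1 * X$2 = k"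
      using k by (auto simp: dual_line_def P field_simps)
    also have "\<dots> \<longleftrightarrow> (X$1 - a$1) * d$2 = (X$2 - a$2) * d$1"
      by (auto simp: k_def algebra_simps)
    also have "\<dots> \<longleftrightarrow> (\<exists>t. X = a + t *\<^sub>R d)"
    proof
      assume h: "(X$1 - a$1) * d$2 = (X$2 - a$2) * d$1"
      show "\<exists>t. X = a + t *\<^sub>R d"
      proof (cases "d$1 = 0")
        case True
        then show ?thesis using h d2
          by (intro exI[of _ "(X$2 - a$2) / d$2"]) (auto simp: vec_eq_iff forall_2 field_simps)
      next
        case False
        then show ?thesis using h
          by (intro exI[of _ "(X$1 - a$1) / d$1"]) (auto simp: vec_eq_iff forall_2 field_simps)
      qed
    qed (auto simp: algebra_simps)
    finally show ?thesis unfolding L by auto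
  qed
  show ?thesis
  proof (rule ex1I[of _ P])
    show "P \<noteq> 0 \<and> L = dual_line P"
      using mem d2 k P by (auto simp: vec_eq_iff forall_2)
  next
    fix Q assume Q: "Q \<noteq> 0 \<and> L = dual_line Q"
    have e1: "Q$1 * a$1 + Q$2 * a$2 = 1" using aL Q by (auto simp: dual_line_def)
    have e2: "Q$1 * d$1 + Q$2 * d$2 = 0"
      using adL e1 Q by (auto simp: dual_line_def algebra_simps)
    have "Q$1 * k = (Q$1 * a$1 + Q$2 * a$2) * d$2 - (Q$1 * d$1 + Q$2 * d$2) * a$2"
      by (simp add: k_def algebra_simps)
    then have q1: "Q$1 * k = d$2" using e1 e2 by simp
    have "Q$2 * k = (Q$1 * d$1 + Q$2 * d$2) * a$1 - (Q$1 * a$1 + Q$2 * a$2) * d$1"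
      by (simp add: k_def algebra_simps)
    then have q2: "Q$2 * k = - d$1" using e1 e2 by simp
    show "Q = P" using q1 q2 k by (simp add: vec_eq_iff forall_2 P field_simps)
  qed
qed

lemma ex1_inverse_point:
  fixes Q :: "real^2"
  assumes "Q \<noteq> 0"
  shows "\<exists>!Q'. (\<exists>t\<ge>0. Q' = t *\<^sub>R Q) \<and> dist 0 Q * dist 0 Q' = 1"
proof (rule ex1I[of _ "(1 / (norm Q)\<^sup>2) *\<^sub>R Q"])
  show "(\<exists>t\<ge>0. (1 / (norm Q)\<^sup>2) *\<^sub>R Q = t *\<^sub>R Q) \<and> dist 0 Q * dist 0 ((1 / (norm Q)\<^sup>2) *\<^sub>R Q) = 1"
    using assms by (auto intro!: exI[of _ "1 / (norm Q)\<^sup>2"] simp: power2_eq_square)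
next
  fix Q' assume "(\<exists>t\<ge>0. Q' = t *\<^sub>R Q) \<and> dist 0 Q * dist 0 Q' = 1"
  then obtain t where t: "t \<ge> 0" "Q' = t *\<^sub>R Q" "norm Q * (t * norm Q) = 1" by auto
  have "t = 1 / (norm Q)\<^sup>2" using t(3) assms by (simp add: field_simps power2_eq_square)
  then show "Q' = (1 / (norm Q)\<^sup>2) *\<^sub>R Q" using t by simp
qed

end

theory Submission
  imports Defs
begin

text \<open>The dual line of \<open>P\<close> is the hyperplane \<open>P \<bullet> X = 1\<close>, so a line contained in it equals it.
  A line through \<open>Q\<close> perpendicular to \<open>OQ\<close> lies in \<open>Q \<bullet> X = Q \<bullet> Q\<close>, which after division
  by \<open>Q \<bullet> Q\<close> is the dual line of the inverse point of \<open>Q\<close>.\<close>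

lemma dual_line_eq_hyperplane: "dual_line P = {X. P \<bullet> X = 1}"
  by (simp add: dual_line_def inner_vec_def sum_2)

text \<open>For \<open>P\<close> nonzero the hyperplane has affine dimension 2 - 1 = 1, the same as
  \<open>L\<close>, and nested affine sets of equal dimension coincide. Only one inclusion then
  remains to be checked.\<close>

lemma line_subset_dual_line_eq:
  assumes L: "is_line L" and sub: "L \<subseteq> dual_line P" and P: "P \<noteq> 0"
  shows "L = dual_line P"
proof (rule affine_dim_equal)
  show "affine L" "L \<noteq> {}" "aff_dim L = aff_dim (dual_line P)"
    using L P by (auto simp: is_line_def dual_line_eq_hyperplane)
  show "affine (dual_line P)"
    by (simp add: dual_line_eq_hyperplane affine_hyperplane)
qed (rule sub)

lemma inverse_point_eq:
  assumes "Q \<noteq> 0"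
  shows "inverse_point Q = Q /\<^sub>R (Q \<bullet> Q)"
  unfolding inverse_point_def
proof (rule the1_equality[OF ex1_inverse_point[OF assms]], intro conjI)
  show "\<exists>t\<ge>0. Q /\<^sub>R (Q \<bullet> Q) = t *\<^sub>R Q"
    by (intro exI[of _ "inverse (Q \<bullet> Q)"]) simp
  show "dist 0 Q * dist 0 (Q /\<^sub>R (Q \<bullet> Q)) = 1"
    using assms by (simp add: dot_square_norm power2_eq_square field_simps)
qed

lemma inverse_point_nonzero: "Q \<noteq> 0 \<Longrightarrow> inverse_point Q \<noteq> 0"
  by (simp add: inverse_point_eq)

text \<open>Dividing by \<open>Q \<bullet> Q\<close> turns the squared norm into its reciprocal, so
  the second division undoes the first.\<close>

lemma inverse_point_inverse_point:
  assumes "Q \<noteq> 0"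
  shows "inverse_point (inverse_point Q) = Q"
  using assms inverse_point_nonzero[OF assms]
  by (simp add: inverse_point_eq)

lemma dual_point_eqI:
  assumes "is_line L" "0 \<notin> L" "P \<noteq> 0" "L = dual_line P"
  shows "dual_point L = P"
  unfolding dual_point_def
  by (rule the1_equality[OF ex1_dual_point]) (use assms in auto)

text \<open>Both halves of the theorem rest on this fact, with \<open>Q\<close> the foot of the
  perpendicular from the origin to \<open>L\<close>.\<close>

lemma perp_line_eq_dual_line_inverse_point:
  assumes perp: "perp_lines L M" and M: "0 \<in> M" "Q \<in> M" and Q: "Q \<in> L" "Q \<noteq> 0"
  shows "L = dual_line (inverse_point Q)"
proof (rule line_subset_dual_line_eq)
  show "is_line L" using perp by (simp add: perp_lines_def)
  show "inverse_point Q \<noteq> 0" using Q by (simp add: inverse_point_nonzero)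
  show "L \<subseteq> dual_line (inverse_point Q)"
  proof
    fix X assume "X \<in> L"
    \<comment> \<open>Perpendicularity is used for the pair \<open>X\<close>, \<open>Q\<close> on
      \<open>L\<close> and the pair \<open>Q\<close>, \<open>0\<close> on \<open>M\<close>.\<close>
    then have "orthogonal (X - Q) (Q - 0)"
      using perp M Q unfolding perp_lines_def by blast
    then have "Q \<bullet> X = Q \<bullet> Q"
      by (simp add: orthogonal_def inner_diff_right inner_commute)
    then show "X \<in> dual_line (inverse_point Q)"
      using Q by (simp add: dual_line_eq_hyperplane inverse_point_eq)
  qed
qed

text \<open>A line through the origin is a subspace, hence closed under scaling.\<close>

lemma inverse_point_mem_line:
  assumes L: "is_line L" "0 \<in> L" and P: "P \<in> L" "P \<noteq> 0"
  shows "inverse_point P \<in> L"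
proof -
  have "subspace L" using L by (simp add: is_line_def subspace_affine)
  then show ?thesis using P by (simp add: inverse_point_eq subspace_scale)
qed

theorem theorem3:
  shows "(\<forall>(L\<^sub>1 :: (real^2) set) L\<^sub>2 P\<^sub>1.
            is_line L\<^sub>1 \<and> 0 \<notin> L\<^sub>1 \<and>
            is_line L\<^sub>2 \<and> 0 \<in> L\<^sub>2 \<and> perp_lines L\<^sub>1 L\<^sub>2 \<and>
            L\<^sub>1 \<inter> L\<^sub>2 = {P\<^sub>1}
            \<longrightarrow> inverse_point P\<^sub>1 = dual_point L\<^sub>1)
       \<and> (\<forall>(P :: real^2) P\<^sub>1 L\<^sub>1 L\<^sub>2.
            P \<noteq> 0 \<and> P\<^sub>1 = inverse_point P \<and>
            is_line L\<^sub>2 \<and> 0 \<in> L\<^sub>2 \<and> P \<in> L\<^sub>2 \<and>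
            is_line L\<^sub>1 \<and> P\<^sub>1 \<in> L\<^sub>1 \<and> perp_lines L\<^sub>1 L\<^sub>2
            \<longrightarrow> L\<^sub>1 = dual_line P)"
proof (intro conjI allI impI; elim conjE)
  fix L\<^sub>1 L\<^sub>2 :: "(real^2) set" and P\<^sub>1
  assume L1: "is_line L\<^sub>1" "0 \<notin> L\<^sub>1" and L2: "0 \<in> L\<^sub>2" "perp_lines L\<^sub>1 L\<^sub>2"
    and "L\<^sub>1 \<inter> L\<^sub>2 = {P\<^sub>1}"
  then have P1: "P\<^sub>1 \<in> L\<^sub>1" "P\<^sub>1 \<in> L\<^sub>2" "P\<^sub>1 \<noteq> 0" by auto
  have "L\<^sub>1 = dual_line (inverse_point P\<^sub>1)"
    using L2 P1 by (intro perp_line_eq_dual_line_inverse_point)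
  then show "inverse_point P\<^sub>1 = dual_point L\<^sub>1"
    by (rule dual_point_eqI[OF L1 inverse_point_nonzero[OF P1(3)], symmetric])
next
  fix P P\<^sub>1 :: "real^2" and L\<^sub>1 L\<^sub>2
  assume P: "P \<noteq> 0" "P\<^sub>1 = inverse_point P"
    and L2: "is_line L\<^sub>2" "0 \<in> L\<^sub>2" "P \<in> L\<^sub>2"
    and L1: "P\<^sub>1 \<in> L\<^sub>1" "perp_lines L\<^sub>1 L\<^sub>2"
  \<comment> \<open>The foot of the perpendicular is here \<open>P\<^sub>1\<close>, not
    \<open>P\<close>, so it must be placed on \<open>L\<^sub>2\<close> first; inverting it
    afterwards gives back \<open>P\<close>.\<close>
  have "P\<^sub>1 \<in> L\<^sub>2" "P\<^sub>1 \<noteq> 0"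
    using P L2 by (simp_all add: inverse_point_mem_line inverse_point_nonzero)
  then have "L\<^sub>1 = dual_line (inverse_point P\<^sub>1)"
    using L1 L2 by (intro perp_line_eq_dual_line_inverse_point)
  then show "L\<^sub>1 = dual_line P"
    using P by (simp add: inverse_point_inverse_point)
qed

end
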